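(* Let $(S,\triangleleft)$ and $(T,\triangleleft)$ be right shelves, let $r_S$ and $r_T$ be the solutions associated with $(S,\triangleleft)$ and $(T,\triangleleft)$, respectively, i.e. $r_S(a,b)=(b\triangleleft a,\,a)$ and $r_T(u,v)=(v\triangleleft u,\,u)$, and let $\alpha:T\to \mathrm{Sym}(S)$ and $\beta:S\to\mathrm{Sym}(T)$ be maps. Write $\alpha_u=\alpha(u)$ and $\beta_a=\beta(a)$ for $u\in T$, $a\in S$. Then the quadruple $(r_S,r_T,\alpha,\beta)$ is a matched product system of solutions if and only if all the maps $\alpha_u$ ($u\in T$) and $\beta_a$ ($a\in S$) are homomorphisms of right shelves and, for all $a,b\in S$ and $u,v\in T$, $$\alpha_{v\triangleleft u}=\alpha_u\alpha_v\alpha_u^{-1},\qquad \beta_{b\triangleleft a}=\beta_a\beta_b\beta_a^{-1},\qquad \alpha_u=\alpha_{\beta_a^{-1}(u)},\qquad \beta_a=\beta_{\alpha_u^{-1}(a)}.$$ In particular, when $(r_S,r_T,\alpha,\beta)$ is a matched product system of solutions, the matched product solution $r_S\bowtie r_T$ on $S\times T$ is given by $$(r_S\bowtie r_T)\big((a,u),(b,v)\big)=\Big(\big(\alpha_u(b)\triangleleft a,\ \beta_a(v)\triangleleft u\big),\ \big(\alpha^{-1}_{v\triangleleft u}(a),\ \beta^{-1}_{b\triangleleft a}(u)\big)\Big)$$ for all $a,b\in S$, $u,v\in T$, and $r_S\bowtie r_T$ is left non-degenerate if and only if $(S,\triangleleft)$ and $(T,\triangleleft)$ are right racks.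
   Context: Sets underlying shelves are taken to be nonempty. Solutions. A (set-theoretical) solution on a set $X$ is a map $r:X\times X\to X\times X$ with $(r\times\mathrm{id}_X)(\mathrm{id}_X\times r)(r\times\mathrm{id}_X)=(\mathrm{id}_X\times r)(r\times\mathrm{id}_X)(\mathrm{id}_X\times r)$. Write $r(x,y)=(\lambda_x(y),\rho_y(x))$. The solution $r$ is left non-degenerate if every $\lambda_x$ is bijective. Right shelves. A right shelf is a set $X$ with a binary operation $\triangleleft$ such that $(x\triangleleft y)\triangleleft z=(x\triangleleft z)\triangleleft(y\triangleleft z)$ for all $x,y,z\in X$. The solution associated with it is $r_\triangleleft(x,y)=(y\triangleleft x,\,x)$. A right rack is a right shelf in which every map $R_y:X\to X$, $R_y(x)=x\triangleleft y$, is bijective. A homomorphism of right shelves is a map $f$ with $f(x\triangleleft y)=f(x)\triangleleft f(y)$. $\mathrm{Sym}(X)$ is the group of bijections $X\to X$; juxtaposition of maps is composition, $fg=f\circ g$. Matched product systems. Given solutions $r_S$ on $S$ and $r_T$ on $T$ (components of both written $\lambda,\rho$, with $a,b\in S$ and $u,v\in T$) and maps $\alpha:T\to\mathrm{Sym}(S)$, $\beta:S\to\mathrm{Sym}(T)$, with $\alpha_u:=\alpha(u)$, $\beta_a:=\beta(a)$, the quadruple $(r_S,r_T,\alpha,\beta)$ is a matched product system of solutions if for all $a,b\in S$, $u,v\in T$: (s1) $\alpha_u\alpha_v=\alpha_{\lambda_u(v)}\alpha_{\rho_v(u)}$; (s2) $\beta_a\beta_b=\beta_{\lambda_a(b)}\beta_{\rho_b(a)}$;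 (s3) $\rho_{\alpha_u^{-1}(b)}\big(\alpha^{-1}_{\beta_a(u)}(a)\big)=\alpha^{-1}_{\beta_{\rho_b(a)}\beta_b^{-1}(u)}\big(\rho_b(a)\big)$; (s4) $\rho_{\beta_a^{-1}(v)}\big(\beta^{-1}_{\alpha_u(a)}(u)\big)=\beta^{-1}_{\alpha_{\rho_v(u)}\alpha_v^{-1}(a)}\big(\rho_v(u)\big)$; (s5) $\lambda_a\alpha_{\beta_a^{-1}(u)}=\alpha_u\lambda_{\alpha_u^{-1}(a)}$; (s6) $\lambda_u\beta_{\alpha_u^{-1}(a)}=\beta_a\lambda_{\beta_a^{-1}(u)}$. Matched product. For a matched product system, the matched product solution $r_S\bowtie r_T$ is the map on $(S\times T)\times(S\times T)$ (known to be a solution on $S\times T$) $$\big((a,u),(b,v)\big)\mapsto\Big(\big(A,U\big),\ \big(\alpha^{-1}_{\overline U}(\rho_{\alpha_{\bar u}(b)}(a)),\ \beta^{-1}_{\overline A}(\rho_{\beta_{\bar a}(v)}(u))\big)\Big),$$ where $\bar a=\alpha_u^{-1}(a)$, $\bar u=\beta_a^{-1}(u)$, $A=\alpha_u(\lambda_{\bar a}(b))$, $U=\beta_a(\lambda_{\bar u}(v))$, $\overline A=\alpha_U^{-1}(A)$, $\overline U=\beta_A^{-1}(U)$. *)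

theory Defs
  imports Main
begin

text \<open>Every set carrying a structure is rendered as a type, hence is nonempty, and \<open>Sym(X)\<close>
  consists of the functions satisfying \<open>bij\<close>.\<close>

text \<open>\<open>r \<times> id\<close> and \<open>id \<times> r\<close> on \<open>X \<times> X \<times> X\<close>; products nest to the right, so only the
  second is a \<open>map_prod\<close>.\<close>

definition braid_left :: "('a \<times> 'a \<Rightarrow> 'a \<times> 'a) \<Rightarrow> 'a \<times> 'a \<times> 'a \<Rightarrow> 'a \<times> 'a \<times> 'a" where
  "braid_left r = (\<lambda>(x, y, z). (fst (r (x, y)), snd (r (x, y)), z))"

definition braid_right :: "('a \<times> 'a \<Rightarrow> 'a \<times> 'a) \<Rightarrow> 'a \<times> 'a \<times> 'a \<Rightarrow> 'a \<times> 'a \<times> 'a" where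
  "braid_right r = map_prod id r"

definition solution :: "('a \<times> 'a \<Rightarrow> 'a \<times> 'a) \<Rightarrow> bool" where
  "solution r \<longleftrightarrow>
     braid_left r \<circ> braid_right r \<circ> braid_left r = braid_right r \<circ> braid_left r \<circ> braid_right r"

definition lam :: "('a \<times> 'a \<Rightarrow> 'a \<times> 'a) \<Rightarrow> 'a \<Rightarrow> 'a \<Rightarrow> 'a" where
  "lam r x y = fst (r (x, y))"

text \<open>The subscript comes first: \<open>rho r y x\<close> is \<open>\<rho>\<^sub>y(x)\<close>, so that
  \<open>r (x, y) = (lam r x y, rho r y x)\<close>.\<close>

definition rho :: "('a \<times> 'a \<Rightarrow> 'a \<times> 'a) \<Rightarrow> 'a \<Rightarrow> 'a \<Rightarrow> 'a" where
  "rho r y x = snd (r (x, y))"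

definition left_nondegenerate :: "('a \<times> 'a \<Rightarrow> 'a \<times> 'a) \<Rightarrow> bool" where
  "left_nondegenerate r \<longleftrightarrow> (\<forall>x. bij (lam r x))"

definition right_shelf :: "('a \<Rightarrow> 'a \<Rightarrow> 'a) \<Rightarrow> bool" where
  "right_shelf f \<longleftrightarrow> (\<forall>x y z. f (f x y) z = f (f x z) (f y z))"

definition right_rack :: "('a \<Rightarrow> 'a \<Rightarrow> 'a) \<Rightarrow> bool" where
  "right_rack f \<longleftrightarrow> right_shelf f \<and> (\<forall>y. bij (\<lambda>x. f x y))"

definition shelf_hom :: "('a \<Rightarrow> 'a \<Rightarrow> 'a) \<Rightarrow> ('b \<Rightarrow> 'b \<Rightarrow> 'b) \<Rightarrow> ('a \<Rightarrow> 'b) \<Rightarrow> bool" where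
  "shelf_hom f g h \<longleftrightarrow> (\<forall>x y. h (f x y) = g (h x) (h y))"

definition shelf_solution :: "('a \<Rightarrow> 'a \<Rightarrow> 'a) \<Rightarrow> 'a \<times> 'a \<Rightarrow> 'a \<times> 'a" where
  "shelf_solution f = (\<lambda>(x, y). (f y x, x))"

definition matched_product_system ::
  "('s \<times> 's \<Rightarrow> 's \<times> 's) \<Rightarrow> ('t \<times> 't \<Rightarrow> 't \<times> 't) \<Rightarrow> ('t \<Rightarrow> 's \<Rightarrow> 's) \<Rightarrow> ('s \<Rightarrow> 't \<Rightarrow> 't) \<Rightarrow> bool" where
  "matched_product_system rS rT \<alpha> \<beta> \<longleftrightarrow>
     solution rS \<and> solution rT \<and> (\<forall>u. bij (\<alpha> u)) \<and> (\<forall>a. bij (\<beta> a)) \<and>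
     (\<forall>u v. \<alpha> u \<circ> \<alpha> v = \<alpha> (lam rT u v) \<circ> \<alpha> (rho rT v u)) \<and>
     (\<forall>a b. \<beta> a \<circ> \<beta> b = \<beta> (lam rS a b) \<circ> \<beta> (rho rS b a)) \<and>
     (\<forall>a b u. rho rS (inv (\<alpha> u) b) (inv (\<alpha> (\<beta> a u)) a) =
        inv (\<alpha> (\<beta> (rho rS b a) (inv (\<beta> b) u))) (rho rS b a)) \<and>
     (\<forall>a u v. rho rT (inv (\<beta> a) v) (inv (\<beta> (\<alpha> u a)) u) =
        inv (\<beta> (\<alpha> (rho rT v u) (inv (\<alpha> v) a))) (rho rT v u)) \<and>
     (\<forall>a u. lam rS a \<circ> \<alpha> (inv (\<beta> a) u) = \<alpha> u \<circ> lam rS (inv (\<alpha> u) a)) \<and>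
     (\<forall>a u. lam rT u \<circ> \<beta> (inv (\<alpha> u) a) = \<beta> a \<circ> lam rT (inv (\<beta> a) u))"

definition matched_product ::
  "('s \<times> 's \<Rightarrow> 's \<times> 's) \<Rightarrow> ('t \<times> 't \<Rightarrow> 't \<times> 't) \<Rightarrow> ('t \<Rightarrow> 's \<Rightarrow> 's) \<Rightarrow> ('s \<Rightarrow> 't \<Rightarrow> 't) \<Rightarrow>
   ('s \<times> 't) \<times> ('s \<times> 't) \<Rightarrow> ('s \<times> 't) \<times> ('s \<times> 't)" where
  "matched_product rS rT \<alpha> \<beta> = (\<lambda>((a, u), (b, v)).
     let abar = inv (\<alpha> u) a;
         ubar = inv (\<beta> a) u;
         A = \<alpha> u (lam rS abar b);
         U = \<beta> a (lam rT ubar v);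
         Abar = inv (\<alpha> U) A;
         Ubar = inv (\<beta> A) U
     in ((A, U),
         (inv (\<alpha> Ubar) (rho rS (\<alpha> ubar b) a),
          inv (\<beta> Abar) (rho rT (\<beta> abar v) u))))"

end

theory Submission
  imports Defs
begin

text \<open>For a solution \<open>r(x, y) = (y \<triangleleft> x, x)\<close> the maps \<open>\<rho>\<^sub>y\<close> are all the identity and \<open>\<lambda>\<^sub>x\<close> is
  the right translation by \<open>x\<close>. The six axioms of a matched product system therefore collapse,
  in pairs exchanged by swapping the two factors; from each pair, the member about \<open>\<alpha>\<close> is described.

  The first says that \<open>\<alpha>\<close> turns \<open>\<triangleleft>\<close> into conjugation
  (\<open>comp_commute_iff_conjugate\<close>).
  The second relates only the values \<open>\<alpha>\<^sub>w\<^sup>-\<^sup>1(a)\<close>, for subscripts \<open>w\<close> that involve the same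
  point \<open>a\<close>; but two choices of the free parameter \<open>b\<close> remove this link and show that \<open>\<alpha>\<close> is
  constant on the orbits of all the maps \<open>\<beta>\<^sub>a\<close> (\<open>subscript_invariant_iff\<close>).
  Once this is known, the twisted subscript in the third may be dropped, and what remains is
  that each \<open>\<alpha>\<^sub>u\<close> is a homomorphism (\<open>twisted_translation_iff_shelf_hom\<close>).

  The same invariance removes all bars from the formula of the matched product. Its left
  translations are then products \<open>(R\<^sub>a \<circ> \<alpha>\<^sub>u) \<times> (R\<^sub>u \<circ> \<beta>\<^sub>a)\<close>, where \<open>R\<close> denotes right translation; as
  \<open>\<alpha>\<^sub>u\<close> and \<open>\<beta>\<^sub>a\<close> are bijective, bijectivity of the product means bijectivity of \<open>R\<^sub>a\<close> and \<open>R\<^sub>u\<close>.\<close>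

lemma lam_shelf_solution [simp]: "lam (shelf_solution f) x = (\<lambda>y. f y x)"
  by (simp add: lam_def shelf_solution_def fun_eq_iff)

lemma rho_shelf_solution [simp]: "rho (shelf_solution f) y x = x"
  by (simp add: rho_def shelf_solution_def)

text \<open>Both sides of the braid equation send \<open>(x, y, z)\<close> to a triple ending in \<open>(y \<triangleleft> x, x)\<close>, and
  self-distributivity is precisely the agreement of the first components.\<close>

lemma solution_shelf_solution: "right_shelf f \<Longrightarrow> solution (shelf_solution f)"
  by (auto simp: solution_def braid_left_def braid_right_def shelf_solution_def
      right_shelf_def fun_eq_iff)

lemma comp_commute_iff_conjugate:
  assumes "bij f"
  shows "f \<circ> g = h \<circ> f \<longleftrightarrow> h = f \<circ> g \<circ> inv f"
  using assms by (metis bij_is_inj bij_is_surj comp_assoc comp_id inv_o_cancel surj_iff)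

text \<open>Taking \<open>b = a\<close> in the left-hand condition removes \<open>\<beta>\<^sub>a\<close> from the subscript wherever the
  argument is \<open>a\<close>; applying this on both sides for arbitrary \<open>b\<close> leaves
  \<open>\<alpha>\<^sub>u\<^sup>-\<^sup>1(a) = \<alpha>\<^sub>w\<^sup>-\<^sup>1(a)\<close> with \<open>w = \<beta>\<^sub>b\<^sup>-\<^sup>1(u)\<close>, where \<open>a\<close> is no longer tied to the subscripts.\<close>

lemma subscript_invariant_iff:
  fixes \<alpha> :: "'t \<Rightarrow> 's \<Rightarrow> 's" and \<beta> :: "'s \<Rightarrow> 't \<Rightarrow> 't"
  assumes \<alpha>: "\<And>u. bij (\<alpha> u)" and \<beta>: "\<And>a. bij (\<beta> a)"
  shows "(\<forall>a b u. inv (\<alpha> (\<beta> a u)) a = inv (\<alpha> (\<beta> a (inv (\<beta> b) u))) a) \<longleftrightarrow>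
         (\<forall>a u. \<alpha> u = \<alpha> (inv (\<beta> a) u))"
    (is "?L \<longleftrightarrow> ?R")
proof
  assume L: ?L
  have pointwise: "inv (\<alpha> (\<beta> a u)) a = inv (\<alpha> u) a" for a u
    using L bij_is_surj[OF \<beta>] by (metis surj_f_inv_f)
  have "inv (\<alpha> u) = inv (\<alpha> (inv (\<beta> b) u))" for b u
    using L by (auto simp: pointwise)
  then show ?R
    by (metis \<alpha> inv_inv_eq)
next
  assume R: ?R
  have "\<alpha> (\<beta> a u) = \<alpha> u" for a u
    using R bij_is_inj[OF \<beta>] by (metis inv_f_f)
  then show ?L
    using R by metis
qed

text \<open>After the subscript is untwisted, every \<open>a\<close> can be written as \<open>\<alpha>\<^sub>u(c)\<close>; with this substitution the
  identity becomes multiplicativity of \<open>\<alpha>\<^sub>u\<close>.\<close>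

lemma twisted_translation_iff_shelf_hom:
  assumes \<alpha>: "\<And>u. bij (\<alpha> u)" and inv: "\<And>a u. \<alpha> u = \<alpha> (inv (\<beta> a) u)"
  shows "(\<forall>a u. (\<lambda>b. f b a) \<circ> \<alpha> (inv (\<beta> a) u) = \<alpha> u \<circ> (\<lambda>b. f b (inv (\<alpha> u) a))) \<longleftrightarrow>
         (\<forall>u. shelf_hom f f (\<alpha> u))"
    (is "?L \<longleftrightarrow> ?R")
proof -
  have "?L \<longleftrightarrow> (\<forall>u a b. f (\<alpha> u b) a = \<alpha> u (f b (inv (\<alpha> u) a)))"
    by (auto simp: fun_eq_iff inv[symmetric])
  also have "\<dots> \<longleftrightarrow> (\<forall>u c b. f (\<alpha> u b) (\<alpha> u c) = \<alpha> u (f b c))"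
    using \<alpha> by (metis bij_inv_eq_iff)
  finally show ?thesis
    unfolding shelf_hom_def by metis
qed

text \<open>The factors can be read off from the product map because types are nonempty.\<close>

lemma bij_map_prod_iff: "bij (map_prod f g) \<longleftrightarrow> bij f \<and> bij g"
proof
  assume bij: "bij (map_prod f g)"
  have "inj f" "inj g"
    using bij_is_inj[OF bij] by (auto simp: inj_def)
  moreover have "surj f" "surj g"
    using bij_is_surj[OF bij] by (auto simp: surj_def)
  ultimately show "bij f \<and> bij g"
    by (simp add: bij_def)
next
  assume "bij f \<and> bij g"
  then show "bij (map_prod f g)"
    by (simp add: bij_def prod.inj_map map_prod_surj)
qed

lemma bij_comp_left_cancel: "bij g \<Longrightarrow> bij (f \<circ> g) \<longleftrightarrow> bij f"
  by (metis bij_betw_comp_iff)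

lemma matched_product_system_shelf_solution_iff:
  fixes f :: "'s \<Rightarrow> 's \<Rightarrow> 's" and g :: "'t \<Rightarrow> 't \<Rightarrow> 't"
  assumes "right_shelf f" "right_shelf g"
    and \<alpha>: "\<And>u. bij (\<alpha> u)" and \<beta>: "\<And>a. bij (\<beta> a)"
  shows "matched_product_system (shelf_solution f) (shelf_solution g) \<alpha> \<beta> \<longleftrightarrow>
    (\<forall>u. shelf_hom f f (\<alpha> u)) \<and> (\<forall>a. shelf_hom g g (\<beta> a)) \<and>
    (\<forall>u v. \<alpha> (g v u) = \<alpha> u \<circ> \<alpha> v \<circ> inv (\<alpha> u)) \<and>
    (\<forall>a b. \<beta> (f b a) = \<beta> a \<circ> \<beta> b \<circ> inv (\<beta> a)) \<and>
    (\<forall>a u. \<alpha> u = \<alpha> (inv (\<beta> a) u)) \<and> (\<forall>a u. \<beta> a = \<beta> (inv (\<alpha> u) a))"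
proof -
  let ?I\<alpha> = "\<forall>a u. \<alpha> u = \<alpha> (inv (\<beta> a) u)" and ?I\<beta> = "\<forall>u a. \<beta> a = \<beta> (inv (\<alpha> u) a)"
  let ?T\<alpha> = "\<forall>a u. (\<lambda>b. f b a) \<circ> \<alpha> (inv (\<beta> a) u) = \<alpha> u \<circ> (\<lambda>b. f b (inv (\<alpha> u) a))"
  let ?T\<beta> = "\<forall>u a. (\<lambda>v. g v u) \<circ> \<beta> (inv (\<alpha> u) a) = \<beta> a \<circ> (\<lambda>v. g v (inv (\<beta> a) u))"
  \<comment> \<open>The \<open>\<beta>\<close>-axiom is the \<open>\<alpha>\<close>-axiom with the factors swapped only after its quantifiers are
    reordered.\<close>
  have swap: "(\<forall>a u v. P a u v) \<longleftrightarrow> (\<forall>u v a. P a u v)" for P :: "'s \<Rightarrow> 't \<Rightarrow> 't \<Rightarrow> bool"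
    by blast
  have "matched_product_system (shelf_solution f) (shelf_solution g) \<alpha> \<beta> \<longleftrightarrow>
    (\<forall>u v. \<alpha> (g v u) = \<alpha> u \<circ> \<alpha> v \<circ> inv (\<alpha> u)) \<and>
    (\<forall>a b. \<beta> (f b a) = \<beta> a \<circ> \<beta> b \<circ> inv (\<beta> a)) \<and>
    ?I\<alpha> \<and> ?I\<beta> \<and> ?T\<alpha> \<and> ?T\<beta>"
    unfolding matched_product_system_def lam_shelf_solution rho_shelf_solution
      comp_commute_iff_conjugate[OF \<alpha>] comp_commute_iff_conjugate[OF \<beta>] swap
      subscript_invariant_iff[of \<alpha> \<beta>, OF \<alpha> \<beta>] subscript_invariant_iff[of \<beta> \<alpha>, OF \<beta> \<alpha>]
    using assms by (simp add: solution_shelf_solution) blast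
  also have "?I\<alpha> \<and> ?I\<beta> \<and> ?T\<alpha> \<and> ?T\<beta> \<longleftrightarrow>
      ?I\<alpha> \<and> ?I\<beta> \<and> (\<forall>u. shelf_hom f f (\<alpha> u)) \<and> (\<forall>a. shelf_hom g g (\<beta> a))"
    using twisted_translation_iff_shelf_hom[of \<alpha> \<beta> f, OF \<alpha>]
      twisted_translation_iff_shelf_hom[of \<beta> \<alpha> g, OF \<beta>] by blast
  finally show ?thesis
    by blast
qed

lemma matched_product_shelf_solution:
  assumes hom: "\<And>u. shelf_hom f f (\<alpha> u)" "\<And>a. shelf_hom g g (\<beta> a)"
    and conj: "\<And>u v. \<alpha> (g v u) = \<alpha> u \<circ> \<alpha> v \<circ> inv (\<alpha> u)"
      "\<And>a b. \<beta> (f b a) = \<beta> a \<circ> \<beta> b \<circ> inv (\<beta> a)"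
    and inv: "\<And>a u. \<alpha> u = \<alpha> (inv (\<beta> a) u)" "\<And>a u. \<beta> a = \<beta> (inv (\<alpha> u) a)"
    and bij: "\<And>u. bij (\<alpha> u)" "\<And>a. bij (\<beta> a)"
  shows "matched_product (shelf_solution f) (shelf_solution g) \<alpha> \<beta> ((a, u), (b, v)) =
    ((f (\<alpha> u b) a, g (\<beta> a v) u), (inv (\<alpha> (g v u)) a, inv (\<beta> (f b a)) u))"
proof -
  have cancel: "\<alpha> w (inv (\<alpha> w) c) = c" "\<beta> c (inv (\<beta> c) w) = w" for c w
    using bij by (simp_all add: bij_is_surj surj_f_inv_f)
  have lam: "\<alpha> u (f b (inv (\<alpha> u) a)) = f (\<alpha> u b) a" "\<beta> a (g v (inv (\<beta> a) u)) = g (\<beta> a v) u"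
    using hom by (simp_all add: shelf_hom_def cancel)
  have "\<alpha> (\<beta> a v) = \<alpha> v" "\<beta> (\<alpha> u b) = \<beta> b"
    using inv bij by (metis bij_is_inj inv_f_f)+
  \<comment> \<open>By conjugation, \<open>\<alpha> (g w u)\<close> depends on \<open>w\<close> only through \<open>\<alpha> w\<close>, and likewise for \<open>\<beta>\<close>.\<close>
  then have "\<alpha> (g (\<beta> a v) u) = \<alpha> (g v u)" "\<beta> (f (\<alpha> u b) a) = \<beta> (f b a)"
    by (simp_all add: conj)
  then show ?thesis
    by (simp add: matched_product_def Let_def lam inv[symmetric])
qed

theorem theorem5:
  fixes opS :: "'s \<Rightarrow> 's \<Rightarrow> 's" (infixl "\<triangleleft>\<^sub>S" 70)
    and opT :: "'t \<Rightarrow> 't \<Rightarrow> 't" (infixl "\<triangleleft>\<^sub>T" 70)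
    and \<alpha> :: "'t \<Rightarrow> 's \<Rightarrow> 's"
    and \<beta> :: "'s \<Rightarrow> 't \<Rightarrow> 't"
  assumes "right_shelf (\<triangleleft>\<^sub>S)"
    and "right_shelf (\<triangleleft>\<^sub>T)"
    and "\<And>u. bij (\<alpha> u)"
    and "\<And>a. bij (\<beta> a)"
  shows "(matched_product_system (shelf_solution (\<triangleleft>\<^sub>S)) (shelf_solution (\<triangleleft>\<^sub>T)) \<alpha> \<beta> \<longleftrightarrow>
      (\<forall>u. shelf_hom (\<triangleleft>\<^sub>S) (\<triangleleft>\<^sub>S) (\<alpha> u)) \<and>
      (\<forall>a. shelf_hom (\<triangleleft>\<^sub>T) (\<triangleleft>\<^sub>T) (\<beta> a)) \<and>
      (\<forall>a b u v.
         \<alpha> (v \<triangleleft>\<^sub>T u) = \<alpha> u \<circ> \<alpha> v \<circ> inv (\<alpha> u) \<and>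
         \<beta> (b \<triangleleft>\<^sub>S a) = \<beta> a \<circ> \<beta> b \<circ> inv (\<beta> a) \<and>
         \<alpha> u = \<alpha> (inv (\<beta> a) u) \<and>
         \<beta> a = \<beta> (inv (\<alpha> u) a))) \<and>
      (matched_product_system (shelf_solution (\<triangleleft>\<^sub>S)) (shelf_solution (\<triangleleft>\<^sub>T)) \<alpha> \<beta> \<longrightarrow>
      (\<forall>a b u v.
         matched_product (shelf_solution (\<triangleleft>\<^sub>S)) (shelf_solution (\<triangleleft>\<^sub>T)) \<alpha> \<beta> ((a, u), (b, v)) =
           ((\<alpha> u b \<triangleleft>\<^sub>S a, \<beta> a v \<triangleleft>\<^sub>T u), (inv (\<alpha> (v \<triangleleft>\<^sub>T u)) a, inv (\<beta> (b \<triangleleft>\<^sub>S a)) u))) \<and>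
      (left_nondegenerate (matched_product (shelf_solution (\<triangleleft>\<^sub>S)) (shelf_solution (\<triangleleft>\<^sub>T)) \<alpha> \<beta>) \<longleftrightarrow>
         right_rack (\<triangleleft>\<^sub>S) \<and> right_rack (\<triangleleft>\<^sub>T)))"
proof -
  let ?r = "matched_product (shelf_solution (\<triangleleft>\<^sub>S)) (shelf_solution (\<triangleleft>\<^sub>T)) \<alpha> \<beta>"
  note system_iff = matched_product_system_shelf_solution_iff[of "(\<triangleleft>\<^sub>S)" "(\<triangleleft>\<^sub>T)" \<alpha> \<beta>, OF assms]
  have product: "?r ((a, u), (b, v)) =
      ((\<alpha> u b \<triangleleft>\<^sub>S a, \<beta> a v \<triangleleft>\<^sub>T u), (inv (\<alpha> (v \<triangleleft>\<^sub>T u)) a, inv (\<beta> (b \<triangleleft>\<^sub>S a)) u))"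
    if "matched_product_system (shelf_solution (\<triangleleft>\<^sub>S)) (shelf_solution (\<triangleleft>\<^sub>T)) \<alpha> \<beta>" for a b u v
    using that[unfolded system_iff] assms(3,4)
    by (intro matched_product_shelf_solution) blast+
  have "left_nondegenerate ?r \<longleftrightarrow> right_rack (\<triangleleft>\<^sub>S) \<and> right_rack (\<triangleleft>\<^sub>T)"
    if "matched_product_system (shelf_solution (\<triangleleft>\<^sub>S)) (shelf_solution (\<triangleleft>\<^sub>T)) \<alpha> \<beta>"
  proof -
    have "lam ?r (a, u) = map_prod ((\<lambda>b. b \<triangleleft>\<^sub>S a) \<circ> \<alpha> u) ((\<lambda>v. v \<triangleleft>\<^sub>T u) \<circ> \<beta> a)" for a u
      by (auto simp: lam_def product[OF that])
    then have "bij (lam ?r (a, u)) \<longleftrightarrow> bij (\<lambda>b. b \<triangleleft>\<^sub>S a) \<and> bij (\<lambda>v. v \<triangleleft>\<^sub>T u)" for a u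
      using assms(3,4) by (simp add: bij_map_prod_iff bij_comp_left_cancel)
    then show ?thesis
      using assms(1,2) by (simp add: left_nondegenerate_def right_rack_def)
  qed
  then show ?thesis
    using product system_iff by auto
qed

end
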